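(* Let $f\in L^1(\mathbb{R}^N)\cap C_0(\mathbb{R}^N)$ with $f\ge0$. Then the $L^1$-solution of the nonlocal Stefan problem $\partial_t u=J*v-v$, $v=(u-1)_+$, $u(\cdot,0)=f$, is continuous (i.e. it coincides a.e. with a continuous function on $\mathbb{R}^N\times[0,\infty)$).
   Context: Standing assumptions: $J:\mathbb{R}^N\to[0,\infty)$ is continuous, compactly supported, radially symmetric, and $\int_{\mathbb{R}^N}J=1$. Here $*$ is convolution in space and $s_+=\max\{s,0\}$. $C_0(\mathbb{R}^N)$ is the set of continuous functions on $\mathbb{R}^N$ tending to $0$ as $|x|\to\infty$. For $f\in L^1(\mathbb{R}^N)$, the $L^1$-solution is the unique $u\in C([0,\infty);L^1(\mathbb{R}^N))$ such that for every $t>0$, $u(t)=f+\int_0^t(J*v(s)-v(s))\,ds$ with $v=(u-1)_+$ a.e.; it is viewed as a function of $(x,t)$ via $u(x,t)=u(t)(x)$. *)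

theory Defs
  imports "HOL-Analysis.Analysis"
begin

text \<open>The space \<open>L\<^sup>1\<close> of integrable real functions modulo equality almost everywhere.  Every
  Lebesgue-integrable class has a Borel representative, so working over \<^const>\<open>lborel\<close> loses
  nothing.\<close>

quotient_type (overloaded) 'a L1 = "'a::euclidean_space \<Rightarrow> real" / partial:
  "\<lambda>f g. integrable lborel f \<and> integrable lborel g \<and> (AE x in lborel. f x = g x)"
  morphisms L1_rep L1_of
proof (rule part_equivpI)
  show "\<exists>f::'a \<Rightarrow> real. integrable lborel f \<and> integrable lborel f \<and> (AE x in lborel. f x = f x)"
    by (rule exI[of _ "\<lambda>_. 0"]) simp
  show "symp (\<lambda>f g :: 'a \<Rightarrow> real. integrable lborel f \<and> integrable lborel g \<and>
          (AE x in lborel. f x = g x))"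
    by (rule sympI) auto
  show "transp (\<lambda>f g :: 'a \<Rightarrow> real. integrable lborel f \<and> integrable lborel g \<and>
          (AE x in lborel. f x = g x))"
    by (rule transpI) auto
qed

lemma L1_rep_integrable: "integrable lborel (L1_rep f)"
  using Quotient_rep_reflp[OF Quotient_L1] by blast

lemma L1_rep_L1_of: "integrable lborel f \<Longrightarrow> AE x in lborel. L1_rep (L1_of f) x = f x"
  using rep_abs_rsp_left[OF Quotient3_L1, of f f] by simp

lemma L1_of_L1_rep: "L1_of (L1_rep f) = f"
  using Quotient3_abs_rep[OF Quotient3_L1] .

instantiation L1 :: (euclidean_space) real_normed_vector
begin

lift_definition zero_L1 :: "'a L1" is "\<lambda>_. 0" by simp

lift_definition plus_L1 :: "'a L1 \<Rightarrow> 'a L1 \<Rightarrow> 'a L1" is "\<lambda>f g x. f x + g x"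
  by auto

lift_definition minus_L1 :: "'a L1 \<Rightarrow> 'a L1 \<Rightarrow> 'a L1" is "\<lambda>f g x. f x - g x"
  by auto

lift_definition uminus_L1 :: "'a L1 \<Rightarrow> 'a L1" is "\<lambda>f x. - f x"
  by auto

lift_definition scaleR_L1 :: "real \<Rightarrow> 'a L1 \<Rightarrow> 'a L1" is "\<lambda>c f x. c * f x"
  by (auto elim: eventually_mono)

lift_definition norm_L1 :: "'a L1 \<Rightarrow> real" is "\<lambda>f. LINT x|lborel. \<bar>f x\<bar>"
  by (rule integral_cong_AE) auto

definition dist_L1 :: "'a L1 \<Rightarrow> 'a L1 \<Rightarrow> real" where "dist_L1 f g = norm (f - g)"

definition sgn_L1 :: "'a L1 \<Rightarrow> 'a L1" where "sgn_L1 f = scaleR (inverse (norm f)) f"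

definition uniformity_L1 :: "('a L1 \<times> 'a L1) filter" where
  "uniformity_L1 = (INF e\<in>{0<..}. principal {(f, g). dist f g < e})"

definition open_L1 :: "'a L1 set \<Rightarrow> bool" where
  "open_L1 U = (\<forall>f\<in>U. \<forall>\<^sub>F (f', g) in uniformity. f' = f \<longrightarrow> g \<in> U)"

instance
proof
  fix f g h :: "'a L1" and a b :: real
  show "f + g + h = f + (g + h)" by transfer (simp add: algebra_simps)
  show "f + g = g + f" by transfer (simp add: algebra_simps)
  show "0 + f = f" by transfer simp
  show "- f + f = 0" by transfer simp
  show "f - g = f + - g" by transfer simp
  show "a *\<^sub>R (f + g) = a *\<^sub>R f + a *\<^sub>R g" by transfer (simp add: algebra_simps)
  show "(a + b) *\<^sub>R f = a *\<^sub>R f + b *\<^sub>R f" by transfer (simp add: algebra_simps)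
  show "a *\<^sub>R b *\<^sub>R f = (a * b) *\<^sub>R f" by transfer (simp add: algebra_simps)
  show "1 *\<^sub>R f = f" by transfer simp
  show "(norm f = 0) = (f = 0)"
  proof transfer
    fix f :: "'a \<Rightarrow> real"
    assume "integrable lborel f \<and> integrable lborel f \<and> (AE x in lborel. f x = f x)"
    then have f: "integrable lborel f" by simp
    then have "(LINT x|lborel. \<bar>f x\<bar>) = 0 \<longleftrightarrow> (AE x in lborel. \<bar>f x\<bar> = 0)"
      by (intro integral_nonneg_eq_0_iff_AE) simp_all
    with f show "((LINT x|lborel. \<bar>f x\<bar>) = 0) =
        (integrable lborel f \<and> integrable lborel (\<lambda>x::'a. 0::real) \<and> (AE x in lborel. f x = 0))"
      by simp
  qed
  show "norm (f + g) \<le> norm f + norm g"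
  proof transfer
    fix f g :: "'a \<Rightarrow> real"
    assume "integrable lborel f \<and> integrable lborel f \<and> (AE x in lborel. f x = f x)"
      and "integrable lborel g \<and> integrable lborel g \<and> (AE x in lborel. g x = g x)"
    then have "integrable lborel f" "integrable lborel g" by simp_all
    then have "(LINT x|lborel. \<bar>f x + g x\<bar>) \<le> (LINT x|lborel. \<bar>f x\<bar> + \<bar>g x\<bar>)"
      by (intro integral_mono) (simp_all add: abs_triangle_ineq)
    with \<open>integrable lborel f\<close> \<open>integrable lborel g\<close>
    show "(LINT x|lborel. \<bar>f x + g x\<bar>) \<le> (LINT x|lborel. \<bar>f x\<bar>) + (LINT x|lborel. \<bar>g x\<bar>)"
      by simp
  qed
  show "norm (a *\<^sub>R f) = \<bar>a\<bar> * norm f"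
    by transfer (simp add: abs_mult)
  show "dist f g = norm (f - g)" by (rule dist_L1_def)
  show "sgn f = inverse (norm f) *\<^sub>R f" by (rule sgn_L1_def)
  show "uniformity = (INF e\<in>{0<..}. principal {(f :: 'a L1, g). dist f g < e})"
    by (rule uniformity_L1_def)
  show "open U = (\<forall>f\<in>U. \<forall>\<^sub>F (f', g) in uniformity. f' = f \<longrightarrow> g \<in> U)" for U :: "'a L1 set"
    by (rule open_L1_def)
qed

end

text \<open>The temperature \<open>v = (u - 1)\<^sub>+\<close> of an enthalpy \<open>u\<close>.\<close>

lift_definition stefan_v :: "'a::euclidean_space L1 \<Rightarrow> 'a L1" is "\<lambda>u x. max (u x - 1) 0"
proof -
  fix u w :: "'a \<Rightarrow> real"
  assume *: "integrable lborel u \<and> integrable lborel w \<and> (AE x in lborel. u x = w x)"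
  have "integrable lborel (\<lambda>x. max (g x - 1) 0)" if "integrable lborel g" for g :: "'a \<Rightarrow> real"
  proof (rule Bochner_Integration.integrable_bound[OF that])
    show "(\<lambda>x. max (g x - 1) 0) \<in> borel_measurable lborel"
      using borel_measurable_integrable[OF that]
      by (intro borel_measurable_max borel_measurable_diff) simp_all
    have "norm (max (g x - 1) 0) \<le> norm (g x)" for x by (simp add: max_def)
    then show "AE x in lborel. norm (max (g x - 1) 0) \<le> norm (g x)" by (rule AE_I2)
  qed
  moreover have "AE x in lborel. max (u x - 1) 0 = max (w x - 1) 0"
    using * by (elim conjE eventually_mono) simp
  ultimately show "integrable lborel (\<lambda>x. max (u x - 1) 0) \<and>
      integrable lborel (\<lambda>x. max (w x - 1) 0) \<and>
      (AE x in lborel. max (u x - 1) 0 = max (w x - 1) 0)"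
    using * by simp
qed

text \<open>For integrable \<open>J\<close> the convolution below is integrable (Fubini) and does not depend on
  the chosen representative of \<open>g\<close>; for other \<open>J\<close> the value may be meaningless.\<close>

definition L1_conv :: "('a::euclidean_space \<Rightarrow> real) \<Rightarrow> 'a L1 \<Rightarrow> 'a L1" where
  "L1_conv J g = L1_of (\<lambda>x. LINT y|lborel. J (x - y) * L1_rep g y)"

text \<open>The \<open>L\<^sup>1\<close>-valued time integral is the gauge integral of the library; the integrand is
  continuous in time, so it agrees with the Bochner (and the Riemann) integral.\<close>

definition L1_solution ::
    "('a::euclidean_space \<Rightarrow> real) \<Rightarrow> 'a L1 \<Rightarrow> (real \<Rightarrow> 'a L1) \<Rightarrow> bool" where
  "L1_solution J f u \<longleftrightarrow> continuous_on {0..} u \<and>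
     (\<forall>t>0. (\<lambda>s. L1_conv J (stefan_v (u s)) - stefan_v (u s)) integrable_on {0..t} \<and>
            u t = f + integral {0..t} (\<lambda>s. L1_conv J (stefan_v (u s)) - stefan_v (u s)))"

end

theory Submission
  imports Defs
begin

text \<open>For an \<open>L\<^sup>1\<close>-solution \<open>u\<close> the source \<open>g = J * v\<close> is jointly continuous: \<open>J\<close> is bounded and
  continuous, and \<open>v\<close> is a continuous curve in \<open>L\<^sup>1\<close>.  For each fixed \<open>x\<close> the scalar equation
  \<open>w' = g - (w - 1)\<^sub>+\<close>, \<open>w(0) = f\<close>, has an explicit solution \<open>w\<close>, because \<open>g \<ge> 0\<close>; it is jointly
  continuous, and \<open>0 \<le> w \<le> f + \<integral>g\<close> makes it integrable in \<open>x\<close>.  Testing the equation of \<open>u - w\<close>, in which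
  \<open>g\<close> cancels, against \<open>sgn (u - w)\<close> gives \<open>\<parallel>u(t) - w(t)\<parallel>\<^sub>1 \<le> \<integral>\<parallel>u(s) - w(s)\<parallel>\<^sub>1 ds\<close>, so \<open>u = w\<close> a.e. by Gronwall.\<close>

section \<open>Representatives of L^1 classes and estimates for the temperature\<close>

lemma L1_rep_plus: "AE x in lborel. L1_rep (a + b) x = L1_rep a x + L1_rep b x"
proof -
  have "a + b = L1_of (\<lambda>x. L1_rep a x + L1_rep b x)"
    using plus_L1.abs_eq[of "L1_rep a" "L1_rep b"] by (simp add: L1_rep_integrable L1_of_L1_rep)
  then show ?thesis
    using L1_rep_L1_of[of "\<lambda>x. L1_rep a x + L1_rep b x"] by (simp add: L1_rep_integrable)
qed

lemma L1_rep_minus: "AE x in lborel. L1_rep (a - b) x = L1_rep a x - L1_rep b x"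
proof -
  have "a - b = L1_of (\<lambda>x. L1_rep a x - L1_rep b x)"
    using minus_L1.abs_eq[of "L1_rep a" "L1_rep b"] by (simp add: L1_rep_integrable L1_of_L1_rep)
  then show ?thesis
    using L1_rep_L1_of[of "\<lambda>x. L1_rep a x - L1_rep b x"] by (simp add: L1_rep_integrable)
qed

lemma L1_rep_scaleR: "AE x in lborel. L1_rep (c *\<^sub>R a) x = c * L1_rep a x"
proof -
  have "c *\<^sub>R a = L1_of (\<lambda>x. c * L1_rep a x)"
    using scaleR_L1.abs_eq[of "L1_rep a" c] by (simp add: L1_rep_integrable L1_of_L1_rep)
  then show ?thesis
    using L1_rep_L1_of[of "\<lambda>x. c * L1_rep a x"] by (simp add: L1_rep_integrable)
qed

lemma integrable_positive_part_shift:
  fixes g :: "'a::euclidean_space \<Rightarrow> real"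
  assumes "integrable lborel g"
  shows "integrable lborel (\<lambda>x. max (g x - 1) 0)"
proof (rule Bochner_Integration.integrable_bound[OF assms])
  show "(\<lambda>x. max (g x - 1) 0) \<in> borel_measurable lborel"
    using borel_measurable_integrable[OF assms] by measurable
qed (auto simp: max_def)

lemma L1_rep_stefan_v: "AE x in lborel. L1_rep (stefan_v a) x = max (L1_rep a x - 1) 0"
proof -
  have "stefan_v a = L1_of (\<lambda>x. max (L1_rep a x - 1) 0)"
    using stefan_v.abs_eq[of "L1_rep a"] by (simp add: L1_rep_integrable L1_of_L1_rep)
  then show ?thesis
    using L1_rep_L1_of[OF integrable_positive_part_shift[OF L1_rep_integrable[of a]]] by simp
qed

lemma norm_stefan_v_le: "norm (stefan_v a) \<le> norm a"
  unfolding norm_L1.rep_eq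
proof (rule integral_mono_AE)
  show "AE x in lborel. \<bar>L1_rep (stefan_v a) x\<bar> \<le> \<bar>L1_rep a x\<bar>"
    using L1_rep_stefan_v[of a] by eventually_elim auto
qed (simp_all add: L1_rep_integrable)

text \<open>Truncation r -> max (r - 1) 0 is 1-Lipschitz, so the temperature along a continuous L^1
  curve is again a continuous curve.\<close>

lemma norm_stefan_v_diff_le: "norm (stefan_v a - stefan_v b) \<le> norm (a - b)"
  unfolding norm_L1.rep_eq
proof (rule integral_mono_AE)
  show "AE x in lborel. \<bar>L1_rep (stefan_v a - stefan_v b) x\<bar> \<le> \<bar>L1_rep (a - b) x\<bar>"
    using L1_rep_stefan_v[of a] L1_rep_stefan_v[of b] L1_rep_minus[of a b]
      L1_rep_minus[of "stefan_v a" "stefan_v b"] by eventually_elim auto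
qed (simp_all add: L1_rep_integrable)

section \<open>Pairing with bounded test functions\<close>

lemma integrable_bounded_mult:
  fixes \<phi> h :: "'a \<Rightarrow> real"
  assumes "\<phi> \<in> borel_measurable M" "\<And>x. \<bar>\<phi> x\<bar> \<le> B" "integrable M h"
  shows "integrable M (\<lambda>x. \<phi> x * h x)"
proof (rule Bochner_Integration.integrable_bound)
  show "integrable M (\<lambda>x. B * h x)" using assms(3) by simp
  show "(\<lambda>x. \<phi> x * h x) \<in> borel_measurable M"
    using assms(1) borel_measurable_integrable[OF assms(3)] by measurable
  have "norm (\<phi> x * h x) \<le> norm (B * h x)" for x
    using assms(2)[of x] by (simp add: abs_mult mult_right_mono)
  then show "AE x in M. norm (\<phi> x * h x) \<le> norm (B * h x)" by simp
qed

text \<open>A bounded linear functional passes under the L^1-valued gauge integral in time, so that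
  integral never has to be evaluated at points x.\<close>

lemma bounded_linear_L1_test:
  fixes \<phi> :: "'a::euclidean_space \<Rightarrow> real"
  assumes "\<phi> \<in> borel_measurable lborel" "\<And>x. \<bar>\<phi> x\<bar> \<le> B"
  shows "bounded_linear (\<lambda>h. LINT x|lborel. \<phi> x * L1_rep h x)"
proof (rule bounded_linear_intro[where K = B])
  have I: "integrable lborel (\<lambda>x. \<phi> x * L1_rep h x)" for h
    by (rule integrable_bounded_mult[OF assms L1_rep_integrable])
  note [measurable] = assms(1) borel_measurable_integrable[OF L1_rep_integrable]
  fix a b :: "'a L1" and c :: real
  have "(LINT x|lborel. \<phi> x * L1_rep (a + b) x) =
      (LINT x|lborel. \<phi> x * L1_rep a x + \<phi> x * L1_rep b x)"
    by (rule integral_cong_AE, measurable)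
      (use L1_rep_plus[of a b] in eventually_elim, simp add: algebra_simps)
  then show "(LINT x|lborel. \<phi> x * L1_rep (a + b) x) =
      (LINT x|lborel. \<phi> x * L1_rep a x) + (LINT x|lborel. \<phi> x * L1_rep b x)"
    by (simp add: I)
  have "(LINT x|lborel. \<phi> x * L1_rep (c *\<^sub>R a) x) = (LINT x|lborel. c * (\<phi> x * L1_rep a x))"
    by (rule integral_cong_AE, measurable)
      (use L1_rep_scaleR[of c a] in eventually_elim, simp add: algebra_simps)
  then show "(LINT x|lborel. \<phi> x * L1_rep (c *\<^sub>R a) x) =
      c *\<^sub>R (LINT x|lborel. \<phi> x * L1_rep a x)"
    by simp
  have "norm (LINT x|lborel. \<phi> x * L1_rep a x) \<le> (LINT x|lborel. norm (\<phi> x * L1_rep a x))"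
    by (rule integral_norm_bound)
  also have "\<dots> \<le> (LINT x|lborel. B * \<bar>L1_rep a x\<bar>)"
    by (rule integral_mono)
      (use integrable_abs[OF I[of a]] in
        \<open>auto simp: L1_rep_integrable abs_mult assms(2) intro!: mult_right_mono\<close>)
  finally show "norm (LINT x|lborel. \<phi> x * L1_rep a x) \<le> norm a * B"
    by (simp add: norm_L1.rep_eq mult.commute)
qed

section \<open>Translation and convolution\<close>

lemma lborel_integrable_translate:
  fixes h :: "'a::euclidean_space \<Rightarrow> real"
  assumes "integrable lborel h"
  shows "integrable lborel (\<lambda>x. h (x - y))"
    and "(LINT x|lborel. h (x - y)) = (LINT x|lborel. h x)"
proof -
  have [measurable]: "h \<in> borel_measurable borel"
    using borel_measurable_integrable[OF assms] by simp
  have m: "(+) (- y) \<in> measurable lborel borel" by measurable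
  have "integrable (distr lborel borel ((+) (- y))) h" using assms by (simp add: lborel_distr_plus)
  then show "integrable lborel (\<lambda>x. h (x - y))"
    by (subst (asm) integrable_distr_eq[OF m]) auto
  have "(LINT x|distr lborel borel ((+) (- y)). h x) = (LINT x|lborel. h (- y + x))"
    by (rule integral_distr[OF m]) simp
  then show "(LINT x|lborel. h (x - y)) = (LINT x|lborel. h x)"
    by (simp add: lborel_distr_plus)
qed

text \<open>Young's inequality for two L^1 functions. Translation invariance gives \<open>n\<close>,
  so the iterated integral of the absolute value is finite and Fubini's theorem applies.\<close>

lemma integrable_convolution:
  fixes J h :: "'a::euclidean_space \<Rightarrow> real"
  assumes J: "integrable lborel J" and h: "integrable lborel h"
  shows "integrable lborel (\<lambda>x. LINT y|lborel. J (x - y) * h y)"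
    and "(LINT x|lborel. \<bar>LINT y|lborel. J (x - y) * h y\<bar>) \<le>
      (LINT x|lborel. \<bar>J x\<bar>) * (LINT x|lborel. \<bar>h x\<bar>)"
proof -
  have [measurable]: "h \<in> borel_measurable borel" "J \<in> borel_measurable borel"
    using borel_measurable_integrable[OF h] borel_measurable_integrable[OF J] by simp_all
  have n: "(LINT x|lborel. norm (J (x - y) * h y)) = (LINT x|lborel. \<bar>J x\<bar>) * \<bar>h y\<bar>" for y
    using lborel_integrable_translate(2)[OF integrable_abs[OF J], of y] by (simp add: abs_mult)
  have int: "integrable (lborel \<Otimes>\<^sub>M lborel) (\<lambda>(y, x). J (x - y) * h y)"
  proof (rule lborel_pair.Fubini_integrable)
    show "(\<lambda>(y, x). J (x - y) * h y) \<in> borel_measurable (lborel \<Otimes>\<^sub>M lborel)" by measurable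
  qed (use n lborel_integrable_translate(1)[OF J] h in auto)
  then show i: "integrable lborel (\<lambda>x. LINT y|lborel. J (x - y) * h y)"
    using lborel_pair.integrable_snd[of "\<lambda>y x. J (x - y) * h y"] by simp
  have inta: "integrable (lborel \<Otimes>\<^sub>M lborel) (\<lambda>(y, x). norm (J (x - y) * h y))"
    using integrable_norm[OF int] by (simp add: case_prod_unfold)
  have "(LINT x|lborel. \<bar>LINT y|lborel. J (x - y) * h y\<bar>) \<le>
      (LINT x|lborel. LINT y|lborel. norm (J (x - y) * h y))"
  proof (rule integral_mono)
    show "integrable lborel (\<lambda>x. LINT y|lborel. norm (J (x - y) * h y))"
      using lborel_pair.integrable_snd[of "\<lambda>y x. norm (J (x - y) * h y)"] inta by simp
    show "\<bar>LINT y|lborel. J (x - y) * h y\<bar> \<le> (LINT y|lborel. norm (J (x - y) * h y))" for x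
      using integral_norm_bound[of lborel "\<lambda>y. J (x - y) * h y"] by simp
  qed (use i in simp)
  also have "\<dots> = (LINT y|lborel. LINT x|lborel. norm (J (x - y) * h y))"
    using lborel_pair.Fubini_integral[of "\<lambda>y x. norm (J (x - y) * h y)"] inta by simp
  also have "\<dots> = (LINT x|lborel. \<bar>J x\<bar>) * (LINT x|lborel. \<bar>h x\<bar>)"
    by (simp only: n) simp
  finally show "(LINT x|lborel. \<bar>LINT y|lborel. J (x - y) * h y\<bar>) \<le>
      (LINT x|lborel. \<bar>J x\<bar>) * (LINT x|lborel. \<bar>h x\<bar>)" .
qed

lemma integrable_bounded_convolution:
  fixes J h :: "'a::euclidean_space \<Rightarrow> real"
  assumes J: "continuous_on UNIV J" and M: "\<And>x. \<bar>J x\<bar> \<le> M" and h: "integrable lborel h"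
  shows "integrable lborel (\<lambda>y. J (x - y) * h y)"
proof (rule integrable_bounded_mult[OF _ _ h])
  have [measurable]: "J \<in> borel_measurable borel" by (rule borel_measurable_continuous_onI[OF J])
  show "(\<lambda>y. J (x - y)) \<in> borel_measurable lborel" by measurable
qed (rule M)

text \<open>Boundedness of \<open>J\<close> provides a majorant, independent of x, for dominated
  convergence.\<close>

lemma continuous_convolution:
  fixes J h :: "'a::euclidean_space \<Rightarrow> real"
  assumes J: "continuous_on UNIV J" and M: "\<And>x. \<bar>J x\<bar> \<le> M" and h: "integrable lborel h"
  shows "continuous_on UNIV (\<lambda>x. LINT y|lborel. J (x - y) * h y)"
proof (rule continuous_at_imp_continuous_on, rule ballI, rule continuous_at_sequentiallyI)
  fix x :: 'a and X assume X: "X \<longlonglongrightarrow> x"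
  have [measurable]: "J \<in> borel_measurable borel" "h \<in> borel_measurable borel"
    using borel_measurable_continuous_onI[OF J] borel_measurable_integrable[OF h] by simp_all
  show "(\<lambda>n. LINT y|lborel. J (X n - y) * h y) \<longlonglongrightarrow> (LINT y|lborel. J (x - y) * h y)"
  proof (rule integral_dominated_convergence[where w = "\<lambda>y. M * \<bar>h y\<bar>"])
    show "integrable lborel (\<lambda>y. M * \<bar>h y\<bar>)" using h by simp
    have "(\<lambda>n. J (X n - y) * h y) \<longlonglongrightarrow> J (x - y) * h y" for y
      by (intro tendsto_intros continuous_on_tendsto_compose[OF J] X) auto
    then show "AE y in lborel. (\<lambda>n. J (X n - y) * h y) \<longlonglongrightarrow> J (x - y) * h y" by simp
    show "AE y in lborel. norm (J (X n - y) * h y) \<le> M * \<bar>h y\<bar>" for n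
      using M by (simp add: abs_mult mult_right_mono)
  qed measurable
qed

text \<open>The increment is split in two: changing the time at the moving point costs at most
  \<open>M * norm (V s - V r)\<close>, uniformly in x, and changing x at a fixed time is covered by
  \<open>continuous_convolution\<close>.\<close>

lemma continuous_convolution_curve:
  fixes J :: "'a::euclidean_space \<Rightarrow> real" and V :: "real \<Rightarrow> 'a L1"
  assumes J: "continuous_on UNIV J" and M: "\<And>x. \<bar>J x\<bar> \<le> M" and V: "continuous_on UNIV V"
  shows "continuous_on UNIV (\<lambda>(x, s). LINT y|lborel. J (x - y) * L1_rep (V s) y)"
proof (rule continuous_at_imp_continuous_on, rule ballI, unfold case_prod_beta)
  let ?g = "\<lambda>x s. LINT y|lborel. J (x - y) * L1_rep (V s) y"
  have I: "integrable lborel (\<lambda>y. J (x - y) * L1_rep a y)" for x a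
    by (rule integrable_bounded_convolution[OF J M L1_rep_integrable])
  have bound: "\<bar>?g x s - ?g x r\<bar> \<le> M * norm (V s - V r)" for x s r
  proof -
    note [measurable] = borel_measurable_continuous_onI[OF J]
      borel_measurable_integrable[OF L1_rep_integrable]
    have "?g x s - ?g x r = (LINT y|lborel. J (x - y) * L1_rep (V s) y - J (x - y) * L1_rep (V r) y)"
      by (simp add: I)
    also have "\<dots> = (LINT y|lborel. J (x - y) * L1_rep (V s - V r) y)"
      by (rule integral_cong_AE, measurable)
        (use L1_rep_minus[of "V s" "V r"] in eventually_elim, simp add: right_diff_distrib)
    finally have "\<bar>?g x s - ?g x r\<bar> \<le> (LINT y|lborel. norm (J (x - y) * L1_rep (V s - V r) y))"
      using integral_norm_bound[of lborel "\<lambda>y. J (x - y) * L1_rep (V s - V r) y"] by simp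
    also have "\<dots> \<le> (LINT y|lborel. M * \<bar>L1_rep (V s - V r) y\<bar>)"
      by (rule integral_mono)
        (use integrable_abs[OF I[of x "V s - V r"]] M in \<open>auto simp: L1_rep_integrable abs_mult intro!: mult_right_mono\<close>)
    finally show ?thesis by (simp add: norm_L1.rep_eq)
  qed
  fix p :: "'a \<times> real"
  have gs: "((\<lambda>q. ?g (fst q) (snd p)) \<longlongrightarrow> ?g (fst p) (snd p)) (at p)"
    by (rule continuous_on_tendsto_compose[OF continuous_convolution[OF J M L1_rep_integrable]])
      (auto intro!: tendsto_intros)
  have "((\<lambda>q. V (snd q)) \<longlongrightarrow> V (snd p)) (at p)"
    by (rule continuous_on_tendsto_compose[OF V]) (auto intro!: tendsto_intros)
  then have "((\<lambda>q. M * norm (V (snd q) - V (snd p))) \<longlongrightarrow> M * norm (V (snd p) - V (snd p))) (at p)"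
    by (intro tendsto_intros)
  then have "((\<lambda>q. M * norm (V (snd q) - V (snd p))) \<longlongrightarrow> 0) (at p)" by simp
  then have "((\<lambda>q. ?g (fst q) (snd q) - ?g (fst q) (snd p)) \<longlongrightarrow> 0) (at p)"
    by (rule Lim_null_comparison[rotated]) (simp add: bound)
  from tendsto_add[OF this gs]
  show "isCont (\<lambda>q. ?g (fst q) (snd q)) p" by (simp add: isCont_def)
qed

section \<open>Exchange of space and time integrals\<close>

text \<open>The L^1 bound \<open>C\<close>, uniform over a bounded time interval, makes \<phi> h
  integrable on the product space, so Fubini's theorem applies. The weight \<phi> serves both as the
  constant 1 and as the sign function of the L^1 comparison.\<close>

lemma integral_space_time_swap:
  fixes h :: "'a::euclidean_space \<Rightarrow> real \<Rightarrow> real"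
  assumes cont: "continuous_on UNIV (\<lambda>(x, s). h x s)"
    and int: "\<And>s. s \<in> {0..t} \<Longrightarrow> integrable lborel (\<lambda>x. h x s)"
    and bound: "\<And>s. s \<in> {0..t} \<Longrightarrow> (LINT x|lborel. \<bar>h x s\<bar>) \<le> C"
    and \<phi>: "\<phi> \<in> borel_measurable lborel" "\<And>x. \<bar>\<phi> x\<bar> \<le> 1"
  shows "integrable lborel (\<lambda>x. \<phi> x * integral {0..t} (h x))"
    and "((\<lambda>s. LINT x|lborel. \<phi> x * h x s) has_integral
           (LINT x|lborel. \<phi> x * integral {0..t} (h x))) {0..t}"
proof -
  \<comment> \<open>The indicator extends the time integral to the whole line, where the product
    measure lives; \<open>in_t\<close> leads back to the gauge integral.\<close>
  define F where "F s x = indicator {0..t} s * (\<phi> x * h x s)" for s :: real and x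
  have "(\<lambda>(x, s). h x s) \<in> borel_measurable (borel \<Otimes>\<^sub>M borel)"
    using borel_measurable_continuous_onI[OF cont] by (simp add: borel_prod)
  from measurable_compose[OF _ this, of "\<lambda>(s, x). (x, s)" "lborel \<Otimes>\<^sub>M lborel"]
  have [measurable]: "(\<lambda>(s, x). h x s) \<in> borel_measurable (lborel \<Otimes>\<^sub>M lborel)"
    by (simp add: case_prod_beta)
  have [measurable]: "\<phi> \<in> borel_measurable borel" using \<phi>(1) by simp
  have F_meas [measurable]: "(\<lambda>(s, x). F s x) \<in> borel_measurable (lborel \<Otimes>\<^sub>M lborel)"
    unfolding F_def by measurable
  have iF: "integrable lborel (\<lambda>x. F s x)" for s
    using integrable_bounded_mult[OF \<phi> int, of s] by (cases "s \<in> {0..t}") (auto simp: F_def)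
  have nF: "(LINT x|lborel. norm (F s x)) \<le> indicator {0..t} s * \<bar>C\<bar>" for s
  proof (cases "s \<in> {0..t}")
    case True
    have "(LINT x|lborel. norm (F s x)) \<le> (LINT x|lborel. \<bar>h x s\<bar>)"
    proof (rule integral_mono)
      show "integrable lborel (\<lambda>x. norm (F s x))" by (rule integrable_norm[OF iF])
      show "integrable lborel (\<lambda>x. \<bar>h x s\<bar>)" using int[OF True] by simp
      show "norm (F s x) \<le> \<bar>h x s\<bar>" for x
        using True mult_right_mono[OF \<phi>(2)[of x], of "\<bar>h x s\<bar>"] by (simp add: F_def abs_mult)
    qed
    with bound[OF True] True show ?thesis by simp
  qed (simp add: F_def)
  have int2: "integrable (lborel \<Otimes>\<^sub>M lborel) (\<lambda>(s, x). F s x)"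
  proof (rule lborel_pair.Fubini_integrable[OF F_meas])
    show "integrable lborel (\<lambda>s. LINT x|lborel. norm (case (s, x) of (s, x) \<Rightarrow> F s x))"
    proof (rule Bochner_Integration.integrable_bound)
      show "integrable lborel (\<lambda>s. indicator {0..t} s * \<bar>C\<bar>)"
        using integrable_real_indicator[of "{0..t}" lborel] by (simp add: emeasure_lborel_Icc_eq)
      show "AE s in lborel. norm (LINT x|lborel. norm (case (s, x) of (s, x) \<Rightarrow> F s x)) \<le>
          norm (indicator {0..t} s * \<bar>C\<bar>)"
        using nF by (auto intro!: AE_I2)
    qed measurable
  qed (simp add: iF)
  have in_t: "(LINT s|lborel. F s x) = \<phi> x * integral {0..t} (h x)" for x
  proof -
    have "continuous_on {0..t} (h x)"
      using continuous_on_compose2[OF cont continuous_on_Pair[OF continuous_on_const continuous_on_id]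
        subset_UNIV] by simp
    then have "set_integrable lborel {0..t} (h x)" by (rule borel_integrable_atLeastAtMost')
    from set_borel_integral_eq_integral(2)[OF this]
    have "integral {0..t} (h x) = (LINT s|lborel. indicator {0..t} s * h x s)"
      by (simp add: set_lebesgue_integral_def)
    then show ?thesis by (simp add: F_def mult.left_commute)
  qed
  show "integrable lborel (\<lambda>x. \<phi> x * integral {0..t} (h x))"
    using lborel_pair.integrable_snd[OF int2] by (simp add: in_t)
  have in_x: "(LINT x|lborel. F s x) = indicator {0..t} s *\<^sub>R (LINT x|lborel. \<phi> x * h x s)" for s
    by (simp add: F_def)
  have "set_integrable lborel {0..t} (\<lambda>s. LINT x|lborel. \<phi> x * h x s)"
    using lborel_pair.integrable_fst[OF int2] unfolding set_integrable_def in_x .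
  note si = set_borel_integral_eq_integral[OF this]
  have "(LINT s:{0..t}|lborel. LINT x|lborel. \<phi> x * h x s) =
      (LINT x|lborel. \<phi> x * integral {0..t} (h x))"
    using lborel_pair.Fubini_integral[OF int2] unfolding in_t
    by (simp add: set_lebesgue_integral_def in_x)
  with si show "((\<lambda>s. LINT x|lborel. \<phi> x * h x s) has_integral
      (LINT x|lborel. \<phi> x * integral {0..t} (h x))) {0..t}"
    by (simp add: has_integral_iff)
qed

section \<open>Primitives depending on parameters\<close>

text \<open>Equal to \<open>\<integral>\<^sub>0\<^sup>t g\<close> for \<open>t \<ge> 0\<close>; the fixed limits of integration give joint continuity in \<open>t\<close> and
  further parameters at once.\<close>

definition scaled_integral :: "(real \<Rightarrow> real) \<Rightarrow> real \<Rightarrow> real" where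
  "scaled_integral g t = t * integral {0..1} (\<lambda>\<sigma>. g (t * \<sigma>))"

lemma scaled_integral_eq:
  assumes "continuous_on UNIV g" "t \<ge> 0"
  shows "scaled_integral g t = integral {0..t} g"
proof (cases "t = 0")
  case False
  with assms have t: "t > 0" by simp
  have "(g has_integral integral {0..t} g) {0..t}"
    by (intro integrable_integral integrable_continuous_real continuous_on_subset[OF assms(1)]) simp
  from has_integral_stretch_real[OF this, of t] t
  have "((\<lambda>\<sigma>. g (t * \<sigma>)) has_integral (integral {0..t} g / t)) {0..1}"
    by (simp add: image_divide_atLeastAtMost)
  with t show ?thesis by (simp add: scaled_integral_def integral_unique)
qed (simp add: scaled_integral_def)

lemma continuous_scaled_integral:
  fixes g :: "'a::topological_space \<Rightarrow> real \<Rightarrow> real"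
  assumes "continuous_on UNIV (\<lambda>(x, s). g x s)"
  shows "continuous_on UNIV (\<lambda>(x, t). scaled_integral (g x) t)"
proof -
  have "continuous_on (UNIV \<times> cbox 0 1) (\<lambda>(z, \<sigma>). g (fst z) (snd z * \<sigma>))"
    using continuous_on_compose2[OF assms, of "UNIV \<times> cbox 0 1" "\<lambda>z. (fst (fst z), snd (fst z) * snd z)"]
    by (simp add: case_prod_unfold continuous_intros)
  from integral_continuous_on_param[OF this]
  have "continuous_on UNIV (\<lambda>z. integral {0..1} (\<lambda>\<sigma>. g (fst z) (snd z * \<sigma>)))" by simp
  then show ?thesis
    unfolding scaled_integral_def case_prod_beta by (intro continuous_intros)
qed

lemma continuous_scaled_integral_single:
  assumes "continuous_on UNIV g"
  shows "continuous_on UNIV (scaled_integral g)"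
proof -
  \<comment> \<open>A dummy real parameter reduces the claim to the joint version.\<close>
  have "continuous_on UNIV (\<lambda>(x :: real, s :: real). (\<lambda>_. g) x s)"
    unfolding case_prod_unfold by (intro continuous_on_compose2[OF assms] continuous_intros) simp
  from continuous_scaled_integral[OF this]
  have "continuous_on UNIV (\<lambda>p :: real \<times> real. scaled_integral g (snd p))"
    by (simp add: case_prod_unfold)
  from continuous_on_compose2[OF this continuous_on_Pair[OF continuous_on_const[of _ 0]
      continuous_on_id] subset_UNIV]
  show ?thesis by simp
qed

section \<open>The scalar equation at a fixed point of space\<close>

text \<open>The solution of \<open>w + \<integral>(w - 1)\<^sub>+ = c + \<integral>g\<close> for \<open>g \<ge> 0\<close>.  As \<open>c + \<integral>g\<close> is nondecreasing, once it
  exceeds the threshold \<open>1\<close> it stays above it.  Hence \<open>v = (w - 1)\<^sub>+\<close> solves the linear equation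
  \<open>v + \<integral>v = (c + \<integral>g - 1)\<^sub>+\<close>, and the subtracted term is the variation of constants formula
  for \<open>\<integral>v\<close>.\<close>

definition stefan_ode :: "real \<Rightarrow> (real \<Rightarrow> real) \<Rightarrow> real \<Rightarrow> real" where
  "stefan_ode c g t = c + scaled_integral g t -
     exp (- t) * scaled_integral (\<lambda>s. exp s * max (c + scaled_integral g s - 1) 0) t"

lemma continuous_stefan_ode:
  fixes c :: "'a::topological_space \<Rightarrow> real"
  assumes "continuous_on UNIV c" and g: "continuous_on UNIV (\<lambda>(x, s). g x s)"
  shows "continuous_on UNIV (\<lambda>(x, t). stefan_ode (c x) (g x) t)"
proof -
  have c: "continuous_on UNIV (\<lambda>p :: 'a \<times> real. c (fst p))"
    by (intro continuous_on_compose2[OF assms(1)] continuous_intros) simp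
  note G = continuous_scaled_integral[OF g, unfolded case_prod_beta]
  have "continuous_on UNIV
      (\<lambda>(x, s). exp s * max (c x + scaled_integral (g x) s - 1) 0)"
    unfolding case_prod_beta by (intro continuous_intros c G)
  note E = continuous_scaled_integral[OF this, unfolded case_prod_beta]
  show ?thesis
    unfolding stefan_ode_def case_prod_beta by (intro continuous_intros c G E)
qed

context
  fixes c :: real and g :: "real \<Rightarrow> real"
  assumes g: "continuous_on UNIV g" "\<And>s. g s \<ge> 0"
begin

text \<open>\<open>exp (- t) * E t\<close> is the candidate for \<integral>v, so the candidate for v
  itself is \<open>q t - exp (- t) * E t\<close>.\<close>

private abbreviation q where "q s \<equiv> max (c + scaled_integral g s - 1) 0"
private abbreviation E where "E \<equiv> scaled_integral (\<lambda>s. exp s * q s)"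

private lemma q_cont: "continuous_on UNIV q"
  by (intro continuous_intros continuous_scaled_integral_single g)

private lemma eq_cont: "continuous_on UNIV (\<lambda>s. exp s * q s)"
  by (intro continuous_intros q_cont)

private lemma q_mono: "0 \<le> s \<Longrightarrow> s \<le> t \<Longrightarrow> q s \<le> q t"
proof -
  assume st: "0 \<le> s" "s \<le> t"
  have i: "g integrable_on {0..r}" for r
    by (intro integrable_continuous_real continuous_on_subset[OF g(1)]) simp
  have "integral {0..s} g \<le> integral {0..t} g"
    by (rule integral_subset_le) (use st i g in auto)
  with st show ?thesis by (simp add: scaled_integral_eq[OF g(1)])
qed

text \<open>\<open>exp (- t) * E t\<close> integrates \<open>q\<close> over [0, t] against the
  weight exp (s - t), whose total mass is 1 - exp (- t) \<le> 1. As \<open>q\<close> is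
  nondecreasing, its final value bounds the result.\<close>

private lemma E_bounds:
  assumes "t \<ge> 0"
  shows "0 \<le> exp (- t) * E t" and "exp (- t) * E t \<le> q t"
proof -
  have i: "(\<lambda>s. exp s * q s) integrable_on {0..t}"
    by (intro integrable_continuous_real continuous_on_subset[OF eq_cont]) simp
  have E: "E t = integral {0..t} (\<lambda>s. exp s * q s)"
    using scaled_integral_eq[OF eq_cont assms] .
  have "0 \<le> E t" unfolding E by (intro integral_nonneg i) simp
  then show "0 \<le> exp (- t) * E t" by simp
  have "((\<lambda>s. exp s * q t) has_integral exp t * q t - exp 0 * q t) {0..t}"
    by (intro fundamental_theorem_of_calculus assms)
      (auto simp flip: has_real_derivative_iff_has_vector_derivative intro!: derivative_eq_intros)
  then have "E t \<le> exp t * q t - exp 0 * q t"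
    unfolding E using q_mono
    by (intro has_integral_le[OF integrable_integral[OF i]]) (auto intro!: mult_left_mono)
  also have "\<dots> \<le> exp t * q t" by simp
  finally have "exp (- t) * E t \<le> exp (- t) * (exp t * q t)" by (intro mult_left_mono) auto
  then show "exp (- t) * E t \<le> q t" by (simp add: exp_minus field_simps)
qed

lemma stefan_ode_upper: "t \<ge> 0 \<Longrightarrow> stefan_ode c g t \<le> c + scaled_integral g t"
  using E_bounds(1) by (simp add: stefan_ode_def)

lemma stefan_ode_nonneg:
  assumes "c \<ge> 0" "t \<ge> 0"
  shows "0 \<le> stefan_ode c g t"
proof -
  have "0 \<le> integral {0..t} g"
    by (intro integral_nonneg integrable_continuous_real continuous_on_subset[OF g(1)]) (auto simp: g)
  \<comment> \<open>The number a = c + \<integral>g is nonnegative, hence max (a - 1) 0 \<le> a. The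
    term subtracted from a is at most \<open>q t\<close>, so it cannot exceed a.\<close>
  with assms have "q t \<le> c + scaled_integral g t"
    by (simp add: scaled_integral_eq[OF g(1)])
  with E_bounds(2)[OF assms(2)] show ?thesis by (simp add: stefan_ode_def)
qed

text \<open>Where \<open>q t > 0\<close>, subtracting 1 from the formula gives the right-hand side,
  which is nonnegative by \<open>E_bounds\<close>. Where \<open>q t = 0\<close>, the two bounds
  force \<open>exp (- t) * E t = 0\<close>, and the solution is at most 1.\<close>

private lemma stefan_ode_positive_part:
  assumes "t \<ge> 0"
  shows "max (stefan_ode c g t - 1) 0 = q t - exp (- t) * E t"
  using E_bounds[OF assms] by (auto simp: stefan_ode_def max_def split: if_splits)

text \<open>The derivative of \<open>exp (- s) * E s\<close> is
  \<open>q s - exp (- s) * E s\<close>, which is (w - 1)_+ by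
  \<open>stefan_ode_positive_part\<close>. Integrating it identifies the subtracted term as
  \<integral>(w - 1)_+.\<close>

lemma stefan_ode_integral_equation:
  assumes "t \<ge> 0"
  shows "stefan_ode c g t = c + integral {0..t} (\<lambda>s. g s - max (stefan_ode c g s - 1) 0)"
proof -
  have "((\<lambda>s. q s - exp (- s) * E s) has_integral exp (- t) * E t - exp (- 0) * E 0) {0..t}"
  proof (rule fundamental_theorem_of_calculus[OF assms])
    fix s assume s: "s \<in> {0..t}"
    have "((\<lambda>s. integral {0..s} (\<lambda>s. exp s * q s)) has_real_derivative exp s * q s) (at s within {0..t})"
      by (rule integral_has_real_derivative[OF continuous_on_subset[OF eq_cont] s]) simp
    then have "(E has_real_derivative exp s * q s) (at s within {0..t})"
      by (rule has_field_derivative_transform_within[where d = 1])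
        (use s in \<open>auto simp: scaled_integral_eq[OF eq_cont]\<close>)
    then have "((\<lambda>s. exp (- s) * E s) has_real_derivative
        exp (- s) * (exp s * q s) - exp (- s) * E s) (at s within {0..t})"
      by (auto intro!: derivative_eq_intros)
    then show "((\<lambda>s. exp (- s) * E s) has_vector_derivative q s - exp (- s) * E s) (at s within {0..t})"
      by (simp add: exp_minus field_simps flip: has_real_derivative_iff_has_vector_derivative)
  qed
  then have v: "((\<lambda>s. max (stefan_ode c g s - 1) 0) has_integral exp (- t) * E t) {0..t}"
    by (subst has_integral_cong[OF stefan_ode_positive_part]) (auto simp: scaled_integral_def)
  have "(g has_integral integral {0..t} g) {0..t}"
    by (intro integrable_integral integrable_continuous_real continuous_on_subset[OF g(1)]) simp
  from integral_unique[OF has_integral_diff[OF this v]] show ?thesis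
    by (simp add: stefan_ode_def scaled_integral_eq[OF g(1) assms])
qed

end

section \<open>A Gronwall argument and the initial value\<close>

text \<open>Iterating \<open>step\<close> from the constant bound gives D t \<le> C t^n / n!, which
  tends to 0. Only the continuous majorants \<open>k\<close> are integrated, so no continuity or
  measurability of \<open>D\<close> has to be established.\<close>

lemma integral_gronwall_zero:
  fixes D :: "real \<Rightarrow> real"
  assumes bound: "\<And>s. s \<in> {0..T} \<Longrightarrow> D s \<le> C"
    and step: "\<And>k t. continuous_on {0..T} k \<Longrightarrow> (\<And>s. s \<in> {0..T} \<Longrightarrow> D s \<le> k s) \<Longrightarrow>
      t \<in> {0..T} \<Longrightarrow> D t \<le> integral {0..t} k"
    and t: "t \<in> {0..T}"
  shows "D t \<le> 0"
proof -
  have "D t \<le> C * (t ^ n / fact n)" if "t \<in> {0..T}" for n t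
    using that
  proof (induction n arbitrary: t)
    case 0
    then show ?case using bound by simp
  next
    case (Suc n)
    let ?k = "\<lambda>s. C * (s ^ n / fact n)"
    have "continuous_on {0..T} ?k" by (intro continuous_intros) simp
    from step[OF this Suc.IH Suc.prems] have D: "D t \<le> integral {0..t} ?k" .
    have "(?k has_integral C * (t ^ Suc n / fact (Suc n)) - C * (0 ^ Suc n / fact (Suc n))) {0..t}"
    proof (rule fundamental_theorem_of_calculus)
      fix s
      have "((\<lambda>s. C * (s ^ Suc n / fact (Suc n))) has_real_derivative
          C * (real (Suc n) * s ^ (Suc n - Suc 0) / fact (Suc n))) (at s within {0..t})"
        by (intro DERIV_cmult DERIV_cdivide DERIV_pow)
      then show "((\<lambda>s. C * (s ^ Suc n / fact (Suc n))) has_vector_derivative ?k s) (at s within {0..t})"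
        by (simp flip: has_real_derivative_iff_has_vector_derivative)
    qed (use Suc.prems in simp)
    then have "integral {0..t} ?k = C * (t ^ Suc n / fact (Suc n)) - C * (0 ^ Suc n / fact (Suc n))"
      by (rule integral_unique)
    with D show ?case by simp
  qed
  with t have "D t \<le> C * (t ^ n / fact n)" for n by blast
  moreover have "(\<lambda>n. C * (t ^ n / fact n)) \<longlonglongrightarrow> C * 0"
    using summable_LIMSEQ_zero[OF summable_exp[of t]]
    by (intro tendsto_intros) (simp add: field_simps)
  ultimately show ?thesis
    by (intro LIMSEQ_le_const[where X = "\<lambda>n. C * (t ^ n / fact n)"]) auto
qed

lemma compact_continuous_norm_bound:
  fixes u :: "'a::topological_space \<Rightarrow> 'b::real_normed_vector"
  assumes "continuous_on S u" "compact S"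
  obtains B where "\<And>s. s \<in> S \<Longrightarrow> norm (u s) \<le> B"
proof -
  obtain B where "\<forall>y\<in>u ` S. norm y \<le> B"
    using compact_imp_bounded[OF compact_continuous_image[OF assms]] unfolding bounded_iff ..
  then show thesis using that[of B] by simp
qed

text \<open>The integral equation is imposed only for t > 0. As \<open>u\<close> is bounded on
  [0, 1], the integral term is O(t), and right continuity of \<open>u\<close> at 0 gives the value
  there.\<close>

lemma L1_solution_initial:
  assumes "L1_solution J f u"
    and bound: "\<And>a. norm (L1_conv J (stefan_v a) - stefan_v a) \<le> K * norm a"
  shows "u 0 = f"
proof -
  have cont: "continuous_on {0..1} u"
    using assms(1) continuous_on_subset[of "{0..}" u "{0..1}"] by (auto simp: L1_solution_def)
  then obtain B where B: "\<And>s. s \<in> {0..1} \<Longrightarrow> norm (u s) \<le> B"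
    by (rule compact_continuous_norm_bound[OF _ compact_Icc]) (rule that)
  define F where "F s = L1_conv J (stefan_v (u s)) - stefan_v (u s)" for s
  have F: "norm (F s) \<le> \<bar>K\<bar> * \<bar>B\<bar>" if "s \<in> {0..1}" for s
  proof -
    have "norm (F s) \<le> K * norm (u s)" unfolding F_def by (rule bound)
    also have "\<dots> \<le> \<bar>K\<bar> * \<bar>B\<bar>" using B[OF that] by (intro mult_mono) auto
    finally show ?thesis .
  qed
  have "norm (u t - f) \<le> \<bar>K\<bar> * \<bar>B\<bar> * t" if t: "t \<in> {0<..<1}" for t
  proof -
    have "F integrable_on {0..t}" and ut: "u t = f + integral {0..t} F"
      using assms(1) t by (auto simp: L1_solution_def F_def[abs_def])
    then have "(F has_integral (u t - f)) (cbox 0 t)" by (auto simp: has_integral_integral)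
    from has_integral_bound[OF _ this, of "\<bar>K\<bar> * \<bar>B\<bar>"] F t show ?thesis by simp
  qed
  then have ev: "\<forall>\<^sub>F t in at_right 0. norm (u t - f) \<le> \<bar>K\<bar> * \<bar>B\<bar> * t"
    by (auto simp: eventually_at_right_field intro!: exI[of _ 1])
  have "((\<lambda>t. \<bar>K\<bar> * \<bar>B\<bar> * t) \<longlongrightarrow> \<bar>K\<bar> * \<bar>B\<bar> * 0) (at_right 0)" by (intro tendsto_intros)
  then have "((\<lambda>t. u t - f) \<longlongrightarrow> 0) (at_right 0)"
    by (intro Lim_null_comparison[OF ev]) simp
  then have "(u \<longlongrightarrow> f) (at_right 0)" by (rule LIM_zero_cancel)
  moreover have "(u \<longlongrightarrow> u 0) (at_right 0)"
    using cont by (simp add: continuous_on_Icc_at_rightD)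
  ultimately show ?thesis using tendsto_unique trivial_limit_at_right_real by blast
qed

section \<open>Convolution as a map on L^1\<close>

lemma L1_rep_L1_conv:
  assumes "integrable lborel J"
  shows "AE x in lborel. L1_rep (L1_conv J h) x = (LINT y|lborel. J (x - y) * L1_rep h y)"
  unfolding L1_conv_def
  by (rule L1_rep_L1_of[OF integrable_convolution(1)[OF assms L1_rep_integrable]])

lemma norm_L1_conv_le:
  assumes "integrable lborel J"
  shows "norm (L1_conv J h) \<le> (LINT x|lborel. \<bar>J x\<bar>) * norm h"
proof -
  have "norm (L1_conv J h) = (LINT x|lborel. \<bar>LINT y|lborel. J (x - y) * L1_rep h y\<bar>)"
    unfolding L1_conv_def
    using integrable_convolution(1)[OF assms L1_rep_integrable] by (simp add: norm_L1.abs_eq)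
  with integrable_convolution(2)[OF assms L1_rep_integrable] show ?thesis
    by (simp add: norm_L1.rep_eq)
qed

section \<open>Construction of the continuous representative\<close>

theorem proposition3p4:
  fixes J f :: "real ^ 'n \<Rightarrow> real" and u :: "real \<Rightarrow> (real ^ 'n) L1"
  assumes "continuous_on UNIV J" and "\<And>x. J x \<ge> 0"
    and "compact (closure {x. J x \<noteq> 0})"
    and "\<And>x y. norm x = norm y \<Longrightarrow> J x = J y"
    and "(LINT x|lborel. J x) = 1"
    and "integrable lborel f"
    and "continuous_on UNIV f" and "(f \<longlongrightarrow> 0) at_infinity"
    and "\<And>x. f x \<ge> 0"
    and "L1_solution J (L1_of f) u"
  shows "\<exists>w :: (real ^ 'n) \<times> real \<Rightarrow> real. continuous_on (UNIV \<times> {0..}) w \<and>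
           (\<forall>t\<ge>0. AE x in lborel. L1_rep (u t) x = w (x, t))"
proof -
  note J = assms(1) and J0 = assms(2) and f = assms(6) and sol = assms(10)
  \<comment> \<open>A nonintegrable function has integral 0 by convention, so the value 1 forces
    integrability.\<close>
  have Ji: "integrable lborel J"
    using assms(5) not_integrable_integral_eq[of lborel J] by (cases "integrable lborel J") simp_all
  have Ja: "(LINT x|lborel. \<bar>J x\<bar>) = 1" by (simp add: abs_of_nonneg[OF J0] assms(5))
  obtain M0 where M0: "\<And>x. x \<in> closure {x. J x \<noteq> 0} \<Longrightarrow> norm (J x) \<le> M0"
    by (rule compact_continuous_norm_bound[OF continuous_on_subset[OF J subset_UNIV] assms(3)])
      (rule that)
  have M: "\<bar>J x\<bar> \<le> \<bar>M0\<bar>" for x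
  proof (cases "J x = 0")
    case False
    then have "x \<in> closure {x. J x \<noteq> 0}" by (intro subsetD[OF closure_subset]) simp
    from M0[OF this] show ?thesis by simp
  qed simp
  have u0: "u 0 = L1_of f"
  \<comment> \<open>\<open>J\<close> has L^1 norm 1, so by Young's inequality J * v and v each
    contribute at most \<open>norm a\<close>; this gives the constant 2.\<close>
  proof (rule L1_solution_initial[OF sol, of 2])
    fix a :: "(real ^ 'n) L1"
    have "norm (L1_conv J (stefan_v a) - stefan_v a) \<le> norm (stefan_v a) + norm (stefan_v a)"
      using norm_triangle_ineq4[of "L1_conv J (stefan_v a)" "stefan_v a"]
        norm_L1_conv_le[OF Ji, of "stefan_v a"] by (simp add: Ja)
    then show "norm (L1_conv J (stefan_v a) - stefan_v a) \<le> 2 * norm a"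
      using norm_stefan_v_le[of a] by simp
  qed

  \<comment> \<open>Freezing the curve at its initial value for s < 0 gives continuity on the whole
    time axis.\<close>
  define V where "V s = stefan_v (u (max s 0))" for s
  have u_cont: "continuous_on UNIV (\<lambda>s. u (max s 0))"
  proof (rule continuous_on_compose2[where t = "{0..}" and g = u])
    show "continuous_on {0..} u" using sol unfolding L1_solution_def by (rule conjunct1)
    show "continuous_on UNIV (\<lambda>s::real. max s 0)" by (intro continuous_intros)
  qed auto
  have V_cont: "continuous_on UNIV V"
  proof (rule continuous_at_imp_continuous_on, rule ballI)
    fix s
    have "((\<lambda>r. u (max r 0)) \<longlongrightarrow> u (max s 0)) (at s)"
      using u_cont by (simp add: continuous_on_def)
    then have "((\<lambda>r. norm (u (max r 0) - u (max s 0))) \<longlongrightarrow> 0) (at s)"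
      by (intro tendsto_norm_zero LIM_zero)
    then have "((\<lambda>r. V r - V s) \<longlongrightarrow> 0) (at s)"
      by (rule Lim_null_comparison[rotated]) (simp add: V_def norm_stefan_v_diff_le)
    then show "isCont V s" by (simp add: isCont_def LIM_zero_iff)
  qed

  \<comment> \<open>Unlike an L^1 class, this has a value at every x; for s \<ge> 0 it represents J
    * v(s).\<close>
  define g where "g x s = (LINT y|lborel. J (x - y) * L1_rep (V s) y)" for x s
  have g_cont: "continuous_on UNIV (\<lambda>(x, s). g x s)"
    unfolding g_def by (rule continuous_convolution_curve[OF J M V_cont])
  have g_cont1: "continuous_on UNIV (g x)" for x
    using continuous_on_compose2[OF g_cont continuous_on_Pair[OF continuous_on_const[of _ x]
      continuous_on_id] subset_UNIV] by simp
  have g0: "g x s \<ge> 0" for x s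
  proof -
    have "AE y in lborel. 0 \<le> J (x - y) * L1_rep (V s) y"
      using L1_rep_stefan_v[of "u (max s 0)"] by eventually_elim (simp add: V_def J0)
    then show ?thesis unfolding g_def by (rule integral_nonneg_AE)
  qed
  have g_int: "integrable lborel (\<lambda>x. g x s)" for s
    unfolding g_def by (rule integrable_convolution(1)[OF Ji L1_rep_integrable])
  have g_norm: "(LINT x|lborel. \<bar>g x s\<bar>) \<le> norm (u s)" if "s \<ge> 0" for s
    using integrable_convolution(2)[OF Ji L1_rep_integrable[of "V s"]] norm_stefan_v_le[of "u s"] that
    unfolding g_def by (simp add: Ja norm_L1.rep_eq V_def)

  define w where "w x t = stefan_ode (f x) (g x) t" for x t
  have w_cont: "continuous_on UNIV (\<lambda>(x, t). w x t)"
    unfolding w_def by (rule continuous_stefan_ode[OF assms(7) g_cont])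
  define h where "h x s = g x s - max (w x s - 1) 0" for x s
  have h_cont: "continuous_on UNIV (\<lambda>(x, s). h x s)"
    using g_cont w_cont unfolding h_def case_prod_unfold by (intro continuous_intros)
  have w_eq: "w x t = f x + integral {0..t} (h x)" if "t \<ge> 0" for x t
    using stefan_ode_integral_equation[OF g_cont1 g0 that] by (simp add: w_def h_def[abs_def])

  \<comment> \<open>Comparison in L^1 up to a fixed time T\<close>
  have "AE x in lborel. L1_rep (u T) x = w x T" if T: "T \<ge> 0" for T
  proof -
    have "continuous_on {0..T} u"
      using sol continuous_on_subset[of "{0..}" u "{0..T}"] by (auto simp: L1_solution_def)
    then obtain B where B: "\<And>s. s \<in> {0..T} \<Longrightarrow> norm (u s) \<le> B"
      by (rule compact_continuous_norm_bound[OF _ compact_Icc]) (rule that)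
    have "norm (u 0) \<le> B" using B T by simp
    then have B0: "B \<ge> 0" using norm_ge_zero order_trans by blast
    have gB: "(LINT x|lborel. \<bar>g x s\<bar>) \<le> B" if "s \<in> {0..T}" for s
      using g_norm[of s] B[OF that] that by simp
    \<comment> \<open>An integrable majorant of w. Its integral is at most \<open>P\<close> for all
      s in [0, T], because \<open>B\<close> bounds the L^1 norm of g on that interval.\<close>
    define p where "p x s = f x + integral {0..s} (g x)" for x s
    define P where "P = (LINT x|lborel. f x) + B * T"
    have p: "integrable lborel (\<lambda>x. p x s)" "(LINT x|lborel. p x s) \<le> P" if s: "s \<in> {0..T}" for s
    proof -
      have sub: "r \<in> {0..T}" if "r \<in> {0..s}" for r using that s by auto
      note Fub = integral_space_time_swap[OF g_cont g_int gB[OF sub], of s "\<lambda>_. 1", simplified]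
      show "integrable lborel (\<lambda>x. p x s)" unfolding p_def by (intro Bochner_Integration.integrable_add f Fub)
      have "(LINT x|lborel. integral {0..s} (g x)) \<le> integral {0..s} (\<lambda>_. B)"
        using Fub(2) gB[OF sub] g0
        by (intro has_integral_le[OF Fub(2) integrable_integral]) auto
      also have "\<dots> \<le> B * T" using s B0 by (simp add: mult.commute mult_left_mono)
      finally show "(LINT x|lborel. p x s) \<le> P"
        unfolding p_def P_def using f Fub(1) by simp
    qed
    have w_le: "w x s \<le> p x s" and w_ge: "0 \<le> w x s" if "s \<in> {0..T}" for x s
      using that stefan_ode_upper[OF g_cont1 g0, of s] stefan_ode_nonneg[OF g_cont1 g0 assms(9), of s]
      by (auto simp: w_def p_def scaled_integral_eq[OF g_cont1])
    have w_meas: "(\<lambda>x. w x s) \<in> borel_measurable borel" for s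
      using continuous_on_compose2[OF w_cont continuous_on_Pair[OF continuous_on_id
        continuous_on_const[of _ s]] subset_UNIV]
      by (intro borel_measurable_continuous_onI) simp
    have w_int: "integrable lborel (\<lambda>x. w x s)" if "s \<in> {0..T}" for s
    proof (rule Bochner_Integration.integrable_bound[OF p(1)[OF that]])
      have "norm (w x s) \<le> norm (p x s)" for x using w_le[OF that, of x] w_ge[OF that, of x] by simp
      then show "AE x in lborel. norm (w x s) \<le> norm (p x s)" by simp
    qed (simp add: w_meas)
    have wP: "(LINT x|lborel. \<bar>w x s\<bar>) \<le> P" if "s \<in> {0..T}" for s
      using integral_mono[OF w_int[OF that] p(1)[OF that] w_le[OF that]] w_ge[OF that] p(2)[OF that]
      by simp
    have v_int: "integrable lborel (\<lambda>x. max (w x s - 1) 0)" if "s \<in> {0..T}" for s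
      by (rule integrable_positive_part_shift[OF w_int[OF that]])
    have h_int: "integrable lborel (\<lambda>x. h x s)" if "s \<in> {0..T}" for s
      unfolding h_def by (intro Bochner_Integration.integrable_diff g_int v_int that)
    have hB: "(LINT x|lborel. \<bar>h x s\<bar>) \<le> B + P" if s: "s \<in> {0..T}" for s
    proof -
      have "(LINT x|lborel. \<bar>h x s\<bar>) \<le> (LINT x|lborel. \<bar>g x s\<bar> + \<bar>w x s\<bar>)"
        by (rule integral_mono) (use h_int g_int w_int s in \<open>auto simp: h_def\<close>)
      also have "\<dots> \<le> B + P" using g_int w_int gB wP s by (simp add: add_mono)
      finally show ?thesis .
    qed

    define D where "D s = (LINT x|lborel. \<bar>L1_rep (u s) x - w x s\<bar>)" for s
    have d_int: "integrable lborel (\<lambda>x. L1_rep (u s) x - w x s)" if "s \<in> {0..T}" for s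
      by (intro Bochner_Integration.integrable_diff L1_rep_integrable w_int that)
    have "D T \<le> 0"
    proof (rule integral_gronwall_zero[where D = D and t = T and T = T and C = "B + P"])
      fix s assume s: "s \<in> {0..T}"
      have "D s \<le> (LINT x|lborel. \<bar>L1_rep (u s) x\<bar> + \<bar>w x s\<bar>)"
        unfolding D_def
        by (rule integral_mono) (use d_int w_int s in \<open>auto simp: L1_rep_integrable\<close>)
      also have "\<dots> \<le> B + P"
        using B[OF s] wP[OF s] w_int[OF s] by (simp add: L1_rep_integrable norm_L1.rep_eq)
      finally show "D s \<le> B + P" .
    next
      fix k t assume k: "continuous_on {0..T} k" and Dk: "\<And>s. s \<in> {0..T} \<Longrightarrow> D s \<le> k s"
        and t: "t \<in> {0..T}"
      have sub: "r \<in> {0..T}" if "r \<in> {0..t}" for r using that t by auto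
      \<comment> \<open>The sign is frozen at the final time t: it is one fixed test function for
        all s in [0, t], and the absolute value is recovered only at time t.\<close>
      define \<phi> where "\<phi> x = sgn (L1_rep (u t) x - w x t)" for x
      have \<phi>: "\<phi> \<in> borel_measurable lborel" "\<bar>\<phi> x\<bar> \<le> 1" for x
        using measurable_compose[OF borel_measurable_integrable[OF d_int[OF t]] borel_measurable_sgn]
        by (simp_all add: \<phi>_def[abs_def] sgn_if)
      note [measurable] = \<phi>(1) borel_measurable_integrable[OF L1_rep_integrable]
      note \<phi>_int = integrable_bounded_mult[OF \<phi>]
      let ?l = "\<lambda>a. LINT x|lborel. \<phi> x * L1_rep a x"
      define F where "F s = L1_conv J (stefan_v (u s)) - stefan_v (u s)" for s
      have "(F has_integral (u t - L1_of f)) {0..t}"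
      \<comment> \<open>At t = 0 the equation is not part of the definition of a solution;
        \<open>u0\<close> makes the difference vanish.\<close>
      proof (cases "t = 0")
        case False
        with t have "F integrable_on {0..t}" "u t = L1_of f + integral {0..t} F"
          using sol by (auto simp: L1_solution_def F_def[abs_def])
        then show ?thesis by (auto simp: has_integral_integral)
      qed (auto simp: u0)
      from has_integral_linear[OF this bounded_linear_L1_test[OF \<phi>]]
      have lu: "((\<lambda>s. ?l (F s)) has_integral ?l (u t - L1_of f)) {0..t}" by (simp add: o_def)
      have lw: "((\<lambda>s. LINT x|lborel. \<phi> x * h x s) has_integral
          (LINT x|lborel. \<phi> x * integral {0..t} (h x))) {0..t}"
        by (rule integral_space_time_swap(2)[OF h_cont h_int[OF sub] hB[OF sub] \<phi>])
      have h_t: "integrable lborel (\<lambda>x. \<phi> x * integral {0..t} (h x))"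
        by (rule integral_space_time_swap(1)[OF h_cont h_int[OF sub] hB[OF sub] \<phi>])
      have "((\<lambda>s. ?l (F s) - (LINT x|lborel. \<phi> x * h x s)) has_integral
          ?l (u t - L1_of f) - (LINT x|lborel. \<phi> x * integral {0..t} (h x))) {0..t}"
        by (rule has_integral_diff[OF lu lw])
      moreover have "(k has_integral integral {0..t} k) {0..t}"
        using t by (intro integrable_integral integrable_continuous_real continuous_on_subset[OF k]) auto
      moreover have "?l (F s) - (LINT x|lborel. \<phi> x * h x s) \<le> k s" if "s \<in> {0..t}" for s
      proof -
        note s = sub[OF that]
        have [measurable]: "(\<lambda>x. h x s) \<in> borel_measurable lborel"
          using borel_measurable_integrable[OF h_int[OF s]] .
        have "?l (F s) - (LINT x|lborel. \<phi> x * h x s) =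
            (LINT x|lborel. \<phi> x * L1_rep (F s) x - \<phi> x * h x s)"
          by (simp add: \<phi>_int L1_rep_integrable h_int[OF s])
        also have "\<dots> \<le> D s"
          unfolding D_def
        proof (rule integral_mono_AE)
          have "V s = stefan_v (u s)" using s by (simp add: V_def)
          note conv = L1_rep_L1_conv[OF Ji, of "V s", folded g_def, unfolded this]
          show "AE x in lborel. \<phi> x * L1_rep (F s) x - \<phi> x * h x s \<le> \<bar>L1_rep (u s) x - w x s\<bar>"
            using conv L1_rep_stefan_v[of "u s"]
              L1_rep_minus[of "L1_conv J (stefan_v (u s))" "stefan_v (u s)"]
          proof eventually_elim
            case (elim x)
            \<comment> \<open>The convolution agrees a.e. with \<open>g x s\<close> and cancels
              against the same term in \<open>h\<close>. What remains is a difference of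
              truncations, controlled by the 1-Lipschitz bound and |\<phi>| \<le> 1.\<close>
            then have "\<phi> x * L1_rep (F s) x - \<phi> x * h x s =
                \<phi> x * (max (w x s - 1) 0 - max (L1_rep (u s) x - 1) 0)"
              by (simp add: F_def h_def right_diff_distrib)
            also have "\<dots> \<le> \<bar>\<phi> x\<bar> * \<bar>max (w x s - 1) 0 - max (L1_rep (u s) x - 1) 0\<bar>"
              by (simp flip: abs_mult)
            also have "\<dots> \<le> 1 * \<bar>L1_rep (u s) x - w x s\<bar>"
              by (intro mult_mono \<phi>) auto
            finally show ?case by simp
          qed
        qed (use d_int[OF s] in \<open>auto simp: \<phi>_int L1_rep_integrable h_int[OF s]\<close>)
        also have "D s \<le> k s" by (rule Dk[OF s])
        finally show ?thesis .
      qed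
      ultimately have "?l (u t - L1_of f) - (LINT x|lborel. \<phi> x * integral {0..t} (h x)) \<le>
          integral {0..t} k"
        by (rule has_integral_le)
      moreover have "D t = ?l (u t - L1_of f) - (LINT x|lborel. \<phi> x * integral {0..t} (h x))"
      proof -
        have [measurable]: "f \<in> borel_measurable borel"
          using borel_measurable_integrable[OF f] by simp
        \<comment> \<open>By the choice of \<phi>, \<phi> (u - w) = |u - w| at time t. Inserting w =
          f + \<integral>h then groups f with u, matching the tested equation.\<close>
        have "D t = (LINT x|lborel. \<phi> x * (L1_rep (u t) x - w x t))"
          by (simp add: D_def \<phi>_def abs_sgn mult.commute)
        also have "\<dots> = (LINT x|lborel. \<phi> x * (L1_rep (u t) x - f x) - \<phi> x * integral {0..t} (h x))"
          using t by (simp add: w_eq algebra_simps)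
        also have "\<dots> = (LINT x|lborel. \<phi> x * (L1_rep (u t) x - f x)) -
            (LINT x|lborel. \<phi> x * integral {0..t} (h x))"
          by (intro Bochner_Integration.integral_diff h_t \<phi>_int Bochner_Integration.integrable_diff
              L1_rep_integrable f)
        also have "(LINT x|lborel. \<phi> x * (L1_rep (u t) x - f x)) = ?l (u t - L1_of f)"
          by (rule integral_cong_AE, measurable)
            (use L1_rep_minus[of "u t" "L1_of f"] L1_rep_L1_of[OF f] in eventually_elim, simp)
        finally show ?thesis .
      qed
      ultimately show "D t \<le> integral {0..t} k" by simp
    qed (use T in simp)
    moreover have "0 \<le> D T" by (simp add: D_def)
    ultimately have "D T = 0" by simp
    then have "AE x in lborel. \<bar>L1_rep (u T) x - w x T\<bar> = 0"
      unfolding D_def using d_int[of T] T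
      by (subst (asm) integral_nonneg_eq_0_iff_AE) auto
    then show ?thesis by simp
  qed
  moreover have "continuous_on (UNIV \<times> {0..}) (\<lambda>(x, t). w x t)"
    by (rule continuous_on_subset[OF w_cont]) simp
  ultimately show ?thesis by (intro exI[of _ "\<lambda>(x, t). w x t"]) simp
qed

end
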